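(* Let $M^2: z=z(u,v)$ be a surface in $\mathbb R^4$ without flat points such that $k=0$ at every point of $M^2$. Then the asymptotic lines of $M^2$ form a one-parameter family, i.e. through each point of $M^2$ there passes locally exactly one asymptotic line (up to reparametrization and restriction of the parameter interval), and every asymptotic line is a principal line.
   Context: $M^2: z=z(u,v)$, $(u,v)\in\mathcal D\subset\mathbb R^2$, is a smooth regular 2-dimensional surface in Euclidean $\mathbb R^4$, with tangent space $T_pM^2=\mathrm{span}\{z_u,z_v\}$. $E,F,G$ are the coefficients of the first fundamental form, and $W=\sqrt{EG-F^2}$. $\{e_1,e_2\}$ is an orthonormal normal frame field chosen so that $\{z_u,z_v,e_1,e_2\}$ is positively oriented in $\mathbb R^4$. $\sigma$ is the vector-valued second fundamental tensor (normal part of the second derivative). The oriented area of the parallelogram of an ordered pair of normal vectors is $S(a^1e_1+a^2e_2,\;b^1e_1+b^2e_2)=a^1b^2-a^2b^1$. Put $L=\frac{2}{W}S(\sigma(z_u,z_u),\sigma(z_u,z_v))$, $M=\frac{1}{W}S(\sigma(z_u,z_u),\sigma(z_v,z_v))$, $N=\frac{2}{W}S(\sigma(z_u,z_v),\sigma(z_v,z_v))$. A point is flat if $L=M=N=0$ there. The invariant $k$ is $k=\frac{LN-M^2}{EG-F^2}$. A tangent at $p$ is a line through the origin of $T_pM^2$, determined by a nonzero vector $X=\lambda z_u+\mu z_v$. Two tangents determined by $\lambda_iz_u+\mu_iz_v$ ($i=1,2$) are conjugate if $L\lambda_1\lambda_2+M(\lambda_1\mu_2+\lambda_2\mu_1)+N\mu_1\mu_2=0$.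 A tangent is asymptotic if it is conjugate to itself, i.e. $L\lambda^2+2M\lambda\mu+N\mu^2=0$. A tangent is principal if it is perpendicular to its conjugate, i.e. if there is a tangent conjugate to it and perpendicular to it. An asymptotic line (respectively principal line) is a smooth regular curve $u=u(q)$, $v=v(q)$, $q$ in an open interval, on $M^2$ whose tangent at every point is asymptotic (respectively principal). *)

theory Defs
  imports "HOL-Analysis.Analysis"
begin

section \<open>Smoothness\<close>

text \<open>
  Only meaningful for an open set \<open>S\<close>, where the derivatives depend only on \<open>f\<close> on \<open>S\<close>.
\<close>

primrec times_diff_on ::
    "nat \<Rightarrow> 'a::real_normed_vector set \<Rightarrow> ('a \<Rightarrow> 'b::real_normed_vector) \<Rightarrow> bool" where
  "times_diff_on 0 S f \<longleftrightarrow> continuous_on S f"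
| "times_diff_on (Suc n) S f \<longleftrightarrow>
     (\<forall>x\<in>S. f differentiable (at x)) \<and>
     (\<forall>w. times_diff_on n S (\<lambda>x. frechet_derivative f (at x) w))"

definition smooth_on ::
    "'a::real_normed_vector set \<Rightarrow> ('a \<Rightarrow> 'b::real_normed_vector) \<Rightarrow> bool" where
  "smooth_on S f \<longleftrightarrow> (\<forall>n. times_diff_on n S f)"

section \<open>Surfaces in four-space\<close>

text \<open>
  A surface is a parametrization \<open>z\<close> on an open parameter domain \<open>D\<close>; its points are
  addressed by their parameters \<open>(u, v)\<close>. A coefficient pair \<open>a = (\<lambda>, \<mu>)\<close> stands for the tangent
  vector \<open>tangent_vec z p a = \<lambda> z\<^sub>u + \<mu> z\<^sub>v\<close>.
\<close>

definition tangent_vec :: "(real \<times> real \<Rightarrow> real^4) \<Rightarrow> real \<times> real \<Rightarrow> real \<times> real \<Rightarrow> real^4" where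
  "tangent_vec z p a = frechet_derivative z (at p) a"

definition z_u :: "(real \<times> real \<Rightarrow> real^4) \<Rightarrow> real \<times> real \<Rightarrow> real^4" where
  "z_u z p = tangent_vec z p (1, 0)"

definition z_v :: "(real \<times> real \<Rightarrow> real^4) \<Rightarrow> real \<times> real \<Rightarrow> real^4" where
  "z_v z p = tangent_vec z p (0, 1)"

definition regular_surface :: "(real \<times> real) set \<Rightarrow> (real \<times> real \<Rightarrow> real^4) \<Rightarrow> bool" where
  "regular_surface D z \<longleftrightarrow>
     open D \<and> smooth_on D z \<and> (\<forall>p\<in>D. inj (frechet_derivative z (at p)))"

definition normal_frame ::
    "(real \<times> real) set \<Rightarrow> (real \<times> real \<Rightarrow> real^4) \<Rightarrow>
     (real \<times> real \<Rightarrow> real^4) \<Rightarrow> (real \<times> real \<Rightarrow> real^4) \<Rightarrow> bool" where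
  "normal_frame D z e1 e2 \<longleftrightarrow>
     smooth_on D e1 \<and> smooth_on D e2 \<and>
     (\<forall>p\<in>D.
        norm (e1 p) = 1 \<and> norm (e2 p) = 1 \<and> e1 p \<bullet> e2 p = 0 \<and>
        e1 p \<bullet> z_u z p = 0 \<and> e1 p \<bullet> z_v z p = 0 \<and>
        e2 p \<bullet> z_u z p = 0 \<and> e2 p \<bullet> z_v z p = 0 \<and>
        det (vector [z_u z p, z_v z p, e1 p, e2 p] :: real^4^4) > 0)"

definition coeff_E :: "(real \<times> real \<Rightarrow> real^4) \<Rightarrow> real \<times> real \<Rightarrow> real" where
  "coeff_E z p = z_u z p \<bullet> z_u z p"

definition coeff_F :: "(real \<times> real \<Rightarrow> real^4) \<Rightarrow> real \<times> real \<Rightarrow> real" where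
  "coeff_F z p = z_u z p \<bullet> z_v z p"

definition coeff_G :: "(real \<times> real \<Rightarrow> real^4) \<Rightarrow> real \<times> real \<Rightarrow> real" where
  "coeff_G z p = z_v z p \<bullet> z_v z p"

definition coeff_W :: "(real \<times> real \<Rightarrow> real^4) \<Rightarrow> real \<times> real \<Rightarrow> real" where
  "coeff_W z p = sqrt (coeff_E z p * coeff_G z p - (coeff_F z p)\<^sup>2)"

definition second_derivative ::
    "(real \<times> real \<Rightarrow> real^4) \<Rightarrow> real \<times> real \<Rightarrow> real \<times> real \<Rightarrow> real \<times> real \<Rightarrow> real^4" where
  "second_derivative z p a b = frechet_derivative (\<lambda>x. frechet_derivative z (at x) b) (at p) a"

text \<open>
  In the following, \<open>e1\<close> and \<open>e2\<close> form a normal frame of \<open>z\<close>, so the projection onto their span is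
  the normal part. The arguments \<open>a\<close>, \<open>b\<close> of \<open>sigma\<close> are coefficient pairs of tangent vectors:
  \<open>sigma z e1 e2 p (1, 0) (0, 1)\<close> is \<open>\<sigma>(z\<^sub>u, z\<^sub>v)\<close>.
\<close>

definition sigma ::
    "(real \<times> real \<Rightarrow> real^4) \<Rightarrow> (real \<times> real \<Rightarrow> real^4) \<Rightarrow> (real \<times> real \<Rightarrow> real^4) \<Rightarrow>
     real \<times> real \<Rightarrow> real \<times> real \<Rightarrow> real \<times> real \<Rightarrow> real^4" where
  "sigma z e1 e2 p a b =
     (second_derivative z p a b \<bullet> e1 p) *\<^sub>R e1 p + (second_derivative z p a b \<bullet> e2 p) *\<^sub>R e2 p"

definition oriented_area ::
    "(real \<times> real \<Rightarrow> real^4) \<Rightarrow> (real \<times> real \<Rightarrow> real^4) \<Rightarrow> real \<times> real \<Rightarrow>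
     real^4 \<Rightarrow> real^4 \<Rightarrow> real" where
  "oriented_area e1 e2 p a b = (a \<bullet> e1 p) * (b \<bullet> e2 p) - (a \<bullet> e2 p) * (b \<bullet> e1 p)"

definition coeff_L ::
    "(real \<times> real \<Rightarrow> real^4) \<Rightarrow> (real \<times> real \<Rightarrow> real^4) \<Rightarrow> (real \<times> real \<Rightarrow> real^4) \<Rightarrow>
     real \<times> real \<Rightarrow> real" where
  "coeff_L z e1 e2 p = 2 / coeff_W z p *
     oriented_area e1 e2 p (sigma z e1 e2 p (1, 0) (1, 0)) (sigma z e1 e2 p (1, 0) (0, 1))"

definition coeff_M ::
    "(real \<times> real \<Rightarrow> real^4) \<Rightarrow> (real \<times> real \<Rightarrow> real^4) \<Rightarrow> (real \<times> real \<Rightarrow> real^4) \<Rightarrow>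
     real \<times> real \<Rightarrow> real" where
  "coeff_M z e1 e2 p = 1 / coeff_W z p *
     oriented_area e1 e2 p (sigma z e1 e2 p (1, 0) (1, 0)) (sigma z e1 e2 p (0, 1) (0, 1))"

definition coeff_N ::
    "(real \<times> real \<Rightarrow> real^4) \<Rightarrow> (real \<times> real \<Rightarrow> real^4) \<Rightarrow> (real \<times> real \<Rightarrow> real^4) \<Rightarrow>
     real \<times> real \<Rightarrow> real" where
  "coeff_N z e1 e2 p = 2 / coeff_W z p *
     oriented_area e1 e2 p (sigma z e1 e2 p (1, 0) (0, 1)) (sigma z e1 e2 p (0, 1) (0, 1))"

definition flat_point ::
    "(real \<times> real \<Rightarrow> real^4) \<Rightarrow> (real \<times> real \<Rightarrow> real^4) \<Rightarrow> (real \<times> real \<Rightarrow> real^4) \<Rightarrow>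
     real \<times> real \<Rightarrow> bool" where
  "flat_point z e1 e2 p \<longleftrightarrow>
     coeff_L z e1 e2 p = 0 \<and> coeff_M z e1 e2 p = 0 \<and> coeff_N z e1 e2 p = 0"

definition invariant_k ::
    "(real \<times> real \<Rightarrow> real^4) \<Rightarrow> (real \<times> real \<Rightarrow> real^4) \<Rightarrow> (real \<times> real \<Rightarrow> real^4) \<Rightarrow>
     real \<times> real \<Rightarrow> real" where
  "invariant_k z e1 e2 p =
     (coeff_L z e1 e2 p * coeff_N z e1 e2 p - (coeff_M z e1 e2 p)\<^sup>2) /
     (coeff_E z p * coeff_G z p - (coeff_F z p)\<^sup>2)"

section \<open>Conjugate, asymptotic and principal tangents\<close>

definition tangent_by ::
    "(real \<times> real \<Rightarrow> real^4) \<Rightarrow> real \<times> real \<Rightarrow> real \<Rightarrow> real \<Rightarrow> (real^4) set" where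
  "tangent_by z p l m = span {l *\<^sub>R z_u z p + m *\<^sub>R z_v z p}"

definition conjugate_tangents ::
    "(real \<times> real \<Rightarrow> real^4) \<Rightarrow> (real \<times> real \<Rightarrow> real^4) \<Rightarrow> (real \<times> real \<Rightarrow> real^4) \<Rightarrow>
     real \<times> real \<Rightarrow> (real^4) set \<Rightarrow> (real^4) set \<Rightarrow> bool" where
  "conjugate_tangents z e1 e2 p g h \<longleftrightarrow>
     (\<exists>l1 m1 l2 m2.
        (l1, m1) \<noteq> (0, 0) \<and> g = tangent_by z p l1 m1 \<and>
        (l2, m2) \<noteq> (0, 0) \<and> h = tangent_by z p l2 m2 \<and>
        coeff_L z e1 e2 p * l1 * l2 + coeff_M z e1 e2 p * (l1 * m2 + m1 * l2) +
          coeff_N z e1 e2 p * m1 * m2 = 0)"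

definition asymptotic_tangent ::
    "(real \<times> real \<Rightarrow> real^4) \<Rightarrow> (real \<times> real \<Rightarrow> real^4) \<Rightarrow> (real \<times> real \<Rightarrow> real^4) \<Rightarrow>
     real \<times> real \<Rightarrow> (real^4) set \<Rightarrow> bool" where
  "asymptotic_tangent z e1 e2 p g \<longleftrightarrow> conjugate_tangents z e1 e2 p g g"

definition principal_tangent ::
    "(real \<times> real \<Rightarrow> real^4) \<Rightarrow> (real \<times> real \<Rightarrow> real^4) \<Rightarrow> (real \<times> real \<Rightarrow> real^4) \<Rightarrow>
     real \<times> real \<Rightarrow> (real^4) set \<Rightarrow> bool" where
  "principal_tangent z e1 e2 p g \<longleftrightarrow>
     (\<exists>h. conjugate_tangents z e1 e2 p g h \<and> (\<forall>x\<in>g. \<forall>y\<in>h. orthogonal x y))"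

section \<open>Curves on the surface\<close>

text \<open>
  A curve on the surface is given by \<open>c q = (u q, v q)\<close> on an open interval \<open>J\<close>,
  possibly unbounded; the curve in space is \<open>z \<circ> c\<close>.
\<close>

definition open_interval :: "real set \<Rightarrow> bool" where
  "open_interval J \<longleftrightarrow> is_interval J \<and> open J \<and> J \<noteq> {}"

definition regular_curve_in ::
    "(real \<times> real) set \<Rightarrow> real set \<Rightarrow> (real \<Rightarrow> real \<times> real) \<Rightarrow> bool" where
  "regular_curve_in D J c \<longleftrightarrow>
     open_interval J \<and> smooth_on J c \<and> c ` J \<subseteq> D \<and>
     (\<forall>q\<in>J. vector_derivative c (at q) \<noteq> 0)"

definition curve_tangent ::
    "(real \<times> real \<Rightarrow> real^4) \<Rightarrow> (real \<Rightarrow> real \<times> real) \<Rightarrow> real \<Rightarrow> (real^4) set" where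
  "curve_tangent z c q = span {vector_derivative (z \<circ> c) (at q)}"

definition asymptotic_line ::
    "(real \<times> real) set \<Rightarrow> (real \<times> real \<Rightarrow> real^4) \<Rightarrow>
     (real \<times> real \<Rightarrow> real^4) \<Rightarrow> (real \<times> real \<Rightarrow> real^4) \<Rightarrow>
     real set \<Rightarrow> (real \<Rightarrow> real \<times> real) \<Rightarrow> bool" where
  "asymptotic_line D z e1 e2 J c \<longleftrightarrow>
     regular_curve_in D J c \<and> (\<forall>q\<in>J. asymptotic_tangent z e1 e2 (c q) (curve_tangent z c q))"

definition principal_line ::
    "(real \<times> real) set \<Rightarrow> (real \<times> real \<Rightarrow> real^4) \<Rightarrow>
     (real \<times> real \<Rightarrow> real^4) \<Rightarrow> (real \<times> real \<Rightarrow> real^4) \<Rightarrow>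
     real set \<Rightarrow> (real \<Rightarrow> real \<times> real) \<Rightarrow> bool" where
  "principal_line D z e1 e2 J c \<longleftrightarrow>
     regular_curve_in D J c \<and> (\<forall>q\<in>J. principal_tangent z e1 e2 (c q) (curve_tangent z c q))"

text \<open>
  The curves \<open>c1\<close> near \<open>q1\<close> and \<open>c2\<close> near \<open>q2\<close> agree up to a regular change of parameter
  \<open>\<phi>\<close> (which may reverse the direction), after shrinking the intervals.
\<close>

definition locally_same_curve ::
    "real set \<Rightarrow> (real \<Rightarrow> real \<times> real) \<Rightarrow> real \<Rightarrow>
     real set \<Rightarrow> (real \<Rightarrow> real \<times> real) \<Rightarrow> real \<Rightarrow> bool" where
  "locally_same_curve J1 c1 q1 J2 c2 q2 \<longleftrightarrow>
     (\<exists>I1 I2 \<phi>.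
        open_interval I1 \<and> I1 \<subseteq> J1 \<and> q1 \<in> I1 \<and>
        open_interval I2 \<and> I2 \<subseteq> J2 \<and> q2 \<in> I2 \<and>
        bij_betw \<phi> I1 I2 \<and> smooth_on I1 \<phi> \<and> (\<forall>q\<in>I1. deriv \<phi> q \<noteq> 0) \<and>
        \<phi> q1 = q2 \<and> (\<forall>q\<in>I1. c1 q = c2 (\<phi> q)))"

end

theory Submission
  imports Defs
begin

text \<open>
  As \<open>L N = M\<^sup>2\<close> and \<open>(L, M, N) \<noteq> 0\<close>, the form \<open>L \<lambda>\<^sup>2 + 2 M \<lambda> \<mu> + N \<mu>\<^sup>2\<close> has rank one at every point:
  it is, up to a factor, the square of a linear form, so exactly one tangent is asymptotic. This
  tangent is spanned by \<open>(- M / L, 1)\<close> or \<open>(1, - M / N)\<close>, whichever makes sense; either is a smooth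
  local vector field \<open>X\<close> (\<open>asymptotic_direction_field\<close>), so the asymptotic lines are its integral
  curves up to reparametrization.

  Existence is the Picard-Lindeloef theorem (\<open>local_integral_curve\<close>), and the solution is smooth
  because \<open>X\<close> is. For uniqueness, one coordinate \<open>l\<close> of \<open>X\<close> is constantly \<open>1\<close>. If \<open>c'\<close> is another
  asymptotic line through \<open>p\<close>, then \<open>c'\<close> and \<open>c \<circ> \<phi>\<close> with \<open>\<phi> = l \<circ> c' - l p\<close> both solve
  \<open>y' = \<phi>' X(y)\<close> with the same initial value, so they agree (\<open>line_field_local_curve\<close>).

  An asymptotic line is principal because the null vectors of a rank one form make up its radical:
  an asymptotic tangent is conjugate to every tangent, so also to its perpendicular.
\<close>

section \<open>Calculus of smooth maps\<close>

lemma times_diff_on_SucD: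
  assumes "times_diff_on (Suc n) S f" "x \<in> S"
  shows "(f has_derivative frechet_derivative f (at x)) (at x)"
  using assms by (simp add: frechet_derivative_works)

lemma times_diff_on_cong:
  assumes "open S" "times_diff_on n S f" "\<And>x. x \<in> S \<Longrightarrow> f x = g x"
  shows "times_diff_on n S g"
  using assms(2,3)
proof (induction n arbitrary: f g)
  case 0
  then show ?case by (simp cong: continuous_on_cong)
next
  case (Suc n)
  have "g differentiable (at x)" if "x \<in> S" for x
    using Suc.prems that \<open>open S\<close>
    by (metis differentiable_def has_derivative_transform_within_open times_diff_on.simps(2))
  moreover have "times_diff_on n S (\<lambda>x. frechet_derivative g (at x) w)" for w
  proof (rule Suc.IH)
    show "times_diff_on n S (\<lambda>x. frechet_derivative f (at x) w)"
      using Suc.prems by simp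
    show "frechet_derivative f (at x) w = frechet_derivative g (at x) w" if "x \<in> S" for x
      using frechet_derivative_transform_within_open[of f x S g] Suc.prems that \<open>open S\<close> by simp
  qed
  ultimately show ?case by simp
qed

lemma times_diff_on_SucI:
  assumes "open S" "\<And>x. x \<in> S \<Longrightarrow> (f has_derivative f' x) (at x)"
    and "\<And>w. times_diff_on n S (\<lambda>x. f' x w)"
  shows "times_diff_on (Suc n) S f"
proof -
  have "times_diff_on n S (\<lambda>x. frechet_derivative f (at x) w)" for w
    by (rule times_diff_on_cong[OF assms(1) assms(3)[of w]])
       (use assms(2) frechet_derivative_at in metis)
  then show ?thesis
    using assms(2) by (auto simp: differentiable_def)
qed

lemma times_diff_on_pred: "times_diff_on (Suc n) S f \<Longrightarrow> times_diff_on n S f"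
proof (induction n arbitrary: f)
  case 0
  then show ?case
    by (auto intro!: continuous_at_imp_continuous_on differentiable_imp_continuous_within)
next
  case (Suc n)
  have "times_diff_on n S (\<lambda>x. frechet_derivative f (at x) w)" for w
    using Suc.prems by (intro Suc.IH) simp
  then show ?case using Suc.prems by simp
qed

lemma times_diff_on_subset:
  "times_diff_on n S f \<Longrightarrow> T \<subseteq> S \<Longrightarrow> times_diff_on n T f"
  by (induction n arbitrary: f) (auto intro: continuous_on_subset)

lemma times_diff_on_const: "times_diff_on n S (\<lambda>x. c)"
  by (induction n arbitrary: c) auto

lemma times_diff_on_bounded_linear:
  assumes "open S" "bounded_linear l" "times_diff_on n S f"
  shows "times_diff_on n S (\<lambda>x. l (f x))"
  using assms(3)
proof (induction n arbitrary: f)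
  case 0
  then show ?case using bounded_linear.continuous_on[OF assms(2)] by simp
next
  case (Suc n)
  show ?case
  proof (rule times_diff_on_SucI[OF \<open>open S\<close>])
    show "((\<lambda>x. l (f x)) has_derivative (\<lambda>w. l (frechet_derivative f (at x) w))) (at x)"
      if "x \<in> S" for x
      by (rule bounded_linear.has_derivative[OF assms(2) times_diff_on_SucD[OF Suc.prems that]])
    show "times_diff_on n S (\<lambda>x. l (frechet_derivative f (at x) w))" for w
      using Suc by simp
  qed
qed

lemma times_diff_on_add:
  assumes "open S" "times_diff_on n S f" "times_diff_on n S g"
  shows "times_diff_on n S (\<lambda>x. f x + g x)"
  using assms(2,3)
proof (induction n arbitrary: f g)
  case 0
  then show ?case by (simp add: continuous_on_add)
next
  case (Suc n)
  show ?case
  proof (rule times_diff_on_SucI[OF \<open>open S\<close>])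
    show "((\<lambda>x. f x + g x) has_derivative
        (\<lambda>w. frechet_derivative f (at x) w + frechet_derivative g (at x) w)) (at x)"
      if "x \<in> S" for x
      using that Suc.prems by (intro has_derivative_add times_diff_on_SucD)
    show "times_diff_on n S (\<lambda>x. frechet_derivative f (at x) w + frechet_derivative g (at x) w)" for w
      using Suc by simp
  qed
qed

lemma times_diff_on_sum:
  assumes "open S" "\<And>i. i \<in> I \<Longrightarrow> times_diff_on n S (f i)"
  shows "times_diff_on n S (\<lambda>x. \<Sum>i\<in>I. f i x)"
  using assms(2)
  by (induction I rule: infinite_finite_induct)
     (auto intro!: times_diff_on_add \<open>open S\<close> simp: times_diff_on_const)

lemma times_diff_on_bounded_bilinear:
  assumes "open S" "bounded_bilinear b" "times_diff_on n S f" "times_diff_on n S g"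
  shows "times_diff_on n S (\<lambda>x. b (f x) (g x))"
  using assms(3,4)
proof (induction n arbitrary: f g)
  case 0
  then show ?case using bounded_bilinear.continuous_on[OF assms(2)] by simp
next
  case (Suc n)
  show ?case
  proof (rule times_diff_on_SucI[OF \<open>open S\<close>])
    show "((\<lambda>x. b (f x) (g x)) has_derivative
        (\<lambda>w. b (f x) (frechet_derivative g (at x) w) + b (frechet_derivative f (at x) w) (g x))) (at x)"
      if "x \<in> S" for x
      using that Suc.prems by (intro bounded_bilinear.FDERIV[OF assms(2)] times_diff_on_SucD)
    show "times_diff_on n S
        (\<lambda>x. b (f x) (frechet_derivative g (at x) w) + b (frechet_derivative f (at x) w) (g x))" for w
      using Suc times_diff_on_pred[OF Suc.prems(1)] times_diff_on_pred[OF Suc.prems(2)]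
      by (intro times_diff_on_add \<open>open S\<close> Suc.IH) auto
  qed
qed

lemma times_diff_on_inverse:
  fixes f :: "'a::real_normed_vector \<Rightarrow> real"
  assumes "open S" "times_diff_on n S f" "\<And>x. x \<in> S \<Longrightarrow> f x \<noteq> 0"
  shows "times_diff_on n S (\<lambda>x. inverse (f x))"
  using assms(2)
proof (induction n)
  case 0
  then show ?case using assms(3) by (simp add: continuous_on_inverse)
next
  case (Suc n)
  show ?case
  proof (rule times_diff_on_SucI[OF \<open>open S\<close>])
    show "((\<lambda>x. inverse (f x)) has_derivative
        (\<lambda>w. - (inverse (f x) * frechet_derivative f (at x) w * inverse (f x)))) (at x)"
      if "x \<in> S" for x
      using that Suc.prems assms(3)
      by (intro Deriv.has_derivative_inverse[OF _ times_diff_on_SucD[OF Suc.prems]]) auto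
    show "times_diff_on n S
        (\<lambda>x. - (inverse (f x) * frechet_derivative f (at x) w * inverse (f x)))" for w
      using Suc.IH times_diff_on_pred[OF Suc.prems] Suc.prems
      by (intro times_diff_on_bounded_linear[OF _ bounded_linear_minus[OF bounded_linear_ident]]
            times_diff_on_bounded_bilinear[OF _ bounded_bilinear_mult] \<open>open S\<close>) auto
  qed
qed

text \<open>
  The chain rule contributes \<open>f'(g x) (g'(x) w)\<close>, whose direction moves with \<open>x\<close>; expanding it in a
  basis leaves only derivatives of \<open>f\<close> in fixed directions, to which the induction hypothesis
  applies.
\<close>

lemma times_diff_on_compose:
  fixes g :: "'a::real_normed_vector \<Rightarrow> 'b::euclidean_space"
  assumes "open S" "times_diff_on n T f" "times_diff_on n S g" "g ` S \<subseteq> T"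
  shows "times_diff_on n S (\<lambda>x. f (g x))"
  using assms(2,3)
proof (induction n arbitrary: f)
  case 0
  then show ?case using assms(4) continuous_on_compose2 by auto
next
  case (Suc n)
  let ?f' = "\<lambda>y. frechet_derivative f (at y)"
  show ?case
  proof (rule times_diff_on_SucI[OF \<open>open S\<close>])
    fix x assume "x \<in> S"
    then have f: "(f has_derivative ?f' (g x)) (at (g x))"
      using assms(4) by (intro times_diff_on_SucD[OF Suc.prems(1)]) auto
    have expand: "?f' (g x) v = (\<Sum>i\<in>Basis. (v \<bullet> i) *\<^sub>R ?f' (g x) i)" for v
    proof -
      have "?f' (g x) v = ?f' (g x) (\<Sum>i\<in>Basis. (v \<bullet> i) *\<^sub>R i)"
        by (simp only: euclidean_representation)
      then show ?thesis
        using has_derivative_linear[OF f] by (simp add: linear_sum linear_cmul)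
    qed
    show "((\<lambda>x. f (g x)) has_derivative
        (\<lambda>w. \<Sum>i\<in>Basis. (frechet_derivative g (at x) w \<bullet> i) *\<^sub>R ?f' (g x) i)) (at x)"
      unfolding expand[symmetric]
      using has_derivative_compose[OF times_diff_on_SucD[OF Suc.prems(2) \<open>x \<in> S\<close>] f] by simp
  next
    show "times_diff_on n S
        (\<lambda>x. \<Sum>i\<in>Basis. (frechet_derivative g (at x) w \<bullet> i) *\<^sub>R ?f' (g x) i)" for w
      using Suc times_diff_on_pred[OF Suc.prems(2)]
      by (intro times_diff_on_sum times_diff_on_bounded_bilinear[OF _ bounded_bilinear_scaleR]
            times_diff_on_bounded_linear[OF _ bounded_linear_inner_left] \<open>open S\<close>) auto
  qed
qed

lemma smooth_on_imp_has_derivative: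
  "smooth_on S f \<Longrightarrow> x \<in> S \<Longrightarrow> (f has_derivative frechet_derivative f (at x)) (at x)"
  using times_diff_on_SucD smooth_on_def by metis

lemma smooth_on_frechet_derivative:
  "smooth_on S f \<Longrightarrow> smooth_on S (\<lambda>x. frechet_derivative f (at x) w)"
  unfolding smooth_on_def by (metis times_diff_on.simps(2))

lemma smooth_on_imp_continuous_on: "smooth_on S f \<Longrightarrow> continuous_on S f"
  unfolding smooth_on_def by (metis times_diff_on.simps(1))

lemma smooth_on_imp_has_vector_derivative:
  "smooth_on J c \<Longrightarrow> q \<in> J \<Longrightarrow> (c has_vector_derivative vector_derivative c (at q)) (at q)"
  by (metis differentiableI smooth_on_imp_has_derivative vector_derivative_works)

lemma smooth_on_imp_continuous_on_vector_derivative: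
  assumes "smooth_on J c"
  shows "continuous_on J (\<lambda>q. vector_derivative c (at q))"
proof -
  have "frechet_derivative c (at q) 1 = vector_derivative c (at q)" if "q \<in> J" for q
    using smooth_on_imp_has_vector_derivative[OF assms that, unfolded has_vector_derivative_def]
    by (metis frechet_derivative_at scaleR_one)
  then show ?thesis
    using smooth_on_imp_continuous_on[OF smooth_on_frechet_derivative[OF assms, of 1]]
    by (simp cong: continuous_on_cong)
qed

text \<open>Bootstrapping: each derivative gained by the solution is gained by its velocity as well.\<close>

lemma smooth_on_integral_curve:
  fixes c :: "real \<Rightarrow> 'a::euclidean_space"
  assumes "open J" "smooth_on U X" "c ` J \<subseteq> U"
    and deriv: "\<And>t. t \<in> J \<Longrightarrow> (c has_vector_derivative X (c t)) (at t)"
  shows "smooth_on J c"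
proof -
  have "times_diff_on n J c" for n
  proof (induction n)
    case 0
    show ?case
      using has_vector_derivative_continuous[OF deriv]
      by (auto intro!: continuous_at_imp_continuous_on)
  next
    case (Suc n)
    show ?case
    proof (rule times_diff_on_SucI[OF \<open>open J\<close>])
      show "(c has_derivative (\<lambda>w. w *\<^sub>R X (c t))) (at t)" if "t \<in> J" for t
        using deriv[OF that] by (simp add: has_vector_derivative_def)
      show "times_diff_on n J (\<lambda>t. w *\<^sub>R X (c t))" for w
        using assms(1-3) Suc unfolding smooth_on_def
        by (intro times_diff_on_bounded_linear[OF _ bounded_linear_scaleR_right]
              times_diff_on_compose[of J n U X]) auto
    qed
  qed
  then show ?thesis by (simp add: smooth_on_def)
qed

section \<open>Integral curves of a vector field\<close>

text \<open>
  The Lipschitz constant comes from the partial derivatives, which are bounded on the compact ball.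
\<close>

lemma smooth_on_imp_lipschitz_cball:
  fixes X :: "'a::euclidean_space \<Rightarrow> 'b::real_normed_vector"
  assumes "smooth_on U X" "cball p r \<subseteq> U"
  obtains K where "K \<ge> 0"
    "\<And>x y. x \<in> cball p r \<Longrightarrow> y \<in> cball p r \<Longrightarrow> norm (X x - X y) \<le> K * norm (x - y)"
proof -
  let ?X' = "\<lambda>x. frechet_derivative X (at x)"
  have "\<exists>B\<ge>0. \<forall>x\<in>cball p r. norm (?X' x i) \<le> B" for i
  proof -
    have "continuous_on (cball p r) (\<lambda>x. ?X' x i)"
      using smooth_on_imp_continuous_on[OF smooth_on_frechet_derivative[OF assms(1)]] assms(2)
        continuous_on_subset by blast
    then have "bounded ((\<lambda>x. ?X' x i) ` cball p r)"
      by (intro compact_imp_bounded compact_continuous_image compact_cball)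
    then obtain b where "b > 0" "\<forall>x\<in>cball p r. norm (?X' x i) \<le> b"
      unfolding bounded_pos by auto
    then show ?thesis by (intro exI[of _ b]) simp
  qed
  then obtain B where B: "\<And>i. B i \<ge> 0" "\<And>i x. x \<in> cball p r \<Longrightarrow> norm (?X' x i) \<le> B i"
    by metis
  define K where "K = (\<Sum>i\<in>Basis. B i)"
  have "norm (X x - X y) \<le> K * norm (x - y)" if "x \<in> cball p r" "y \<in> cball p r" for x y
  proof (rule differentiable_bound[OF convex_cball _ _ that])
    fix x assume x: "x \<in> cball p r"
    then have der: "(X has_derivative ?X' x) (at x)"
      using smooth_on_imp_has_derivative[OF assms(1)] assms(2) by auto
    then show "(X has_derivative ?X' x) (at x within cball p r)"
      by (rule has_derivative_at_withinI)
    have lin: "linear (?X' x)" using der by (rule has_derivative_linear)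
    show "onorm (?X' x) \<le> K"
    proof (rule onorm_le)
      fix v :: 'a
      have "?X' x v = ?X' x (\<Sum>i\<in>Basis. (v \<bullet> i) *\<^sub>R i)" by (simp add: euclidean_representation)
      also have "\<dots> = (\<Sum>i\<in>Basis. (v \<bullet> i) *\<^sub>R ?X' x i)"
        using lin by (simp add: linear_sum linear_cmul)
      also have "norm \<dots> \<le> (\<Sum>i\<in>Basis. norm v * B i)"
        using B x by (intro sum_norm_le) (auto simp: Basis_le_norm intro!: mult_mono)
      finally show "norm (?X' x v) \<le> K * norm v"
        by (simp add: K_def sum_distrib_left mult.commute)
    qed
  qed
  moreover have "K \<ge> 0" unfolding K_def using B by (simp add: sum_nonneg)
  ultimately show thesis using that by blast
qed

text \<open>
  Picard's operator \<open>c \<mapsto> p + \<integral>\<^sub>0\<^sup>t X (c s) ds\<close> is a contraction for short times. It is written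
  with integrals from \<open>- T\<close>, which avoids integrating backwards at the price of the constant \<open>3\<close>,
  and with time clamped to \<open>{- T..T}\<close>, so that it acts on the complete space of bounded continuous
  functions on the whole line.
\<close>

lemma lipschitz_imp_integral_curve:
  fixes X :: "'a::euclidean_space \<Rightarrow> 'a"
  assumes "T > 0" "K \<ge> 0" "3 * T * K < 1"
    and lip: "\<And>x y. norm (X x - X y) \<le> K * norm (x - y)"
  obtains c where "c 0 = p"
    "\<And>t. t \<in> {-T<..<T} \<Longrightarrow> (c has_vector_derivative X (c t)) (at t)"
proof -
  have "K-lipschitz_on UNIV X"
    using lip \<open>K \<ge> 0\<close> by (auto intro!: lipschitz_onI simp: dist_norm)
  then have "continuous_on UNIV X" by (rule lipschitz_on_continuous_on)
  then have cont: "continuous_on A (\<lambda>s. X (apply_bcontfun c s))" for A and c :: "real \<Rightarrow>\<^sub>C 'a"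
    by (rule continuous_on_compose2) auto
  define I where "I c t = integral {-T..t} (\<lambda>s. X (apply_bcontfun c s))" for c t
  define clamp where "clamp t = max (-T) (min T t)" for t
  define P where "P c t = p + (I c (clamp t) - I c 0)" for c t
  have clamp: "clamp t \<in> {-T..T}" for t using \<open>T > 0\<close> by (auto simp: clamp_def)
  have contI: "continuous_on {-T..T} (I c)" for c
    unfolding I_def by (intro indefinite_integral_continuous_1 integrable_continuous_real cont)
  have "P c \<in> bcontfun" for c
  proof -
    have "continuous_on UNIV (\<lambda>t. I c (clamp t))"
      by (rule continuous_on_compose2[OF contI]) (use clamp in \<open>auto simp: clamp_def intro!: continuous_intros\<close>)
    then have "continuous_on UNIV (P c)"
      unfolding P_def by (intro continuous_intros)
    moreover have "bounded ((\<lambda>t. p + (I c t - I c 0)) ` {-T..T})"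
      by (intro compact_imp_bounded compact_continuous_image continuous_intros contI) auto
    then have "bounded (range (P c))"
      by (rule bounded_subset) (use clamp in \<open>auto simp: P_def\<close>)
    ultimately show ?thesis by (simp add: bcontfun_def)
  qed
  then have P: "apply_bcontfun (Bcontfun (P c)) = P c" for c
    by (simp add: Bcontfun_inverse)
  have Idiff: "norm (I c t - I d t) \<le> K * dist c d * (t + T)" if "t \<in> {-T..T}" for c d t
  proof -
    have "I c t - I d t = integral {-T..t} (\<lambda>s. X (c s) - X (d s))"
      unfolding I_def by (intro Henstock_Kurzweil_Integration.integral_diff[symmetric] integrable_continuous_real cont)
    also have "norm \<dots> \<le> K * dist c d * (t - (-T))"
    proof (rule integral_bound)
      show "norm (X (c s) - X (d s)) \<le> K * dist c d" for s
        using lip[of "c s" "d s"] dist_bounded[of c s d] \<open>K \<ge> 0\<close>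
        by (smt (verit) dist_norm mult_left_mono)
    qed (use that in \<open>auto intro!: continuous_intros cont\<close>)
    finally show ?thesis by simp
  qed
  have contract: "dist (Bcontfun (P c)) (Bcontfun (P d)) \<le> 3 * T * K * dist c d" for c d
  proof (rule dist_bound)
    fix t
    have "dist (P c t) (P d t) = norm ((I c (clamp t) - I d (clamp t)) - (I c 0 - I d 0))"
      by (simp add: P_def dist_norm algebra_simps)
    also have "\<dots> \<le> K * dist c d * (clamp t + T) + K * dist c d * (0 + T)"
      using \<open>T > 0\<close> by (intro norm_triangle_le_diff add_mono Idiff clamp) auto
    also have "\<dots> \<le> K * dist c d * (T + T) + K * dist c d * (0 + T)"
      using clamp \<open>K \<ge> 0\<close> by (intro add_mono mult_left_mono) auto
    also have "\<dots> = 3 * T * K * dist c d" by (simp add: algebra_simps)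
    finally show "dist (apply_bcontfun (Bcontfun (P c)) t) (apply_bcontfun (Bcontfun (P d)) t)
        \<le> 3 * T * K * dist c d"
      by (simp add: P)
  qed
  have "\<exists>!c. Bcontfun (P c) = c"
    by (rule banach_fix_type[of "3 * T * K"]) (use assms contract in auto)
  then obtain c where "Bcontfun (P c) = c" by blast
  then have c: "apply_bcontfun c t = P c t" for t using P by metis
  show thesis
  proof (rule that[of "apply_bcontfun c"])
    show "apply_bcontfun c 0 = p"
      using \<open>T > 0\<close> by (simp add: c P_def clamp_def)
    fix t assume t: "t \<in> {-T<..<T}"
    have "(I c has_vector_derivative X (c t)) (at t within {-T..T})"
      unfolding I_def by (rule integral_has_vector_derivative) (use t cont in auto)
    then have "(I c has_vector_derivative X (c t)) (at t)"
      using t at_within_Icc_at[of "-T" t T] by simp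
    then have "((\<lambda>t. p + (I c t - I c 0)) has_vector_derivative X (c t)) (at t)"
      by (auto intro!: derivative_eq_intros)
    then show "(apply_bcontfun c has_vector_derivative X (c t)) (at t)"
      by (rule has_vector_derivative_transform_within_open[of _ _ _ "{-T<..<T}"])
         (use t in \<open>auto simp: c P_def clamp_def\<close>)
  qed
qed

text \<open>
  Precomposing the field with the metric projection onto the ball makes it globally Lipschitz with
  the same constant, and for short times the solution does not leave the ball.
\<close>

lemma local_integral_curve:
  fixes X :: "'a::euclidean_space \<Rightarrow> 'a"
  assumes "r > 0" "K \<ge> 0"
    and lip: "\<And>x y. x \<in> cball p r \<Longrightarrow> y \<in> cball p r \<Longrightarrow> norm (X x - X y) \<le> K * norm (x - y)"
  obtains T c where "T > 0" "c 0 = p" "c ` {-T<..<T} \<subseteq> ball p r"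
    "\<And>t. t \<in> {-T<..<T} \<Longrightarrow> (c has_vector_derivative X (c t)) (at t)"
proof -
  let ?\<pi> = "closest_point (cball p r)"
  have ne: "cball p r \<noteq> {}" using \<open>r > 0\<close> by simp
  have \<pi>: "?\<pi> x \<in> cball p r" for x
    by (rule closest_point_in_set[OF closed_cball ne])
  have lip\<pi>: "norm (X (?\<pi> x) - X (?\<pi> y)) \<le> K * norm (x - y)" for x y
    using lip[OF \<pi> \<pi>, of x y] closest_point_lipschitz[OF convex_cball closed_cball ne, of x y]
      \<open>K \<ge> 0\<close> by (smt (verit) dist_norm mult_left_mono)
  define S where "S = 1 / (3 * (K + 1))"
  have "S > 0" "3 * S * K < 1" using \<open>K \<ge> 0\<close> by (auto simp: S_def field_simps)
  from lipschitz_imp_integral_curve[OF \<open>S > 0\<close> \<open>K \<ge> 0\<close> this(2), of "\<lambda>x. X (?\<pi> x)", OF lip\<pi>]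
  obtain c where c0: "c 0 = p"
    and c: "\<And>t. t \<in> {-S<..<S} \<Longrightarrow> (c has_vector_derivative X (?\<pi> (c t))) (at t)"
    by blast
  have "continuous (at 0) c"
    using c[of 0] \<open>S > 0\<close> has_vector_derivative_continuous by auto
  then obtain d where d: "d > 0" "\<And>t. dist t 0 < d \<Longrightarrow> dist (c t) (c 0) < r"
    using \<open>r > 0\<close> unfolding continuous_at_eps_delta by metis
  show thesis
  proof (rule that[of "min S d" c])
    show img: "c ` {-min S d<..<min S d} \<subseteq> ball p r"
      using d(2) c0 by (auto simp: dist_real_def dist_commute abs_less_iff)
    fix t assume t: "t \<in> {-min S d<..<min S d}"
    then have "c t \<in> cball p r" using img by force
    then have "?\<pi> (c t) = c t" by (rule closest_point_self)
    then show "(c has_vector_derivative X (c t)) (at t)" using c[of t] t by auto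
  qed (use \<open>S > 0\<close> d(1) c0 in auto)
qed

text \<open>
  Where \<open>norm (c1 - c2)\<close> attains its maximum over the short interval, the mean value inequality
  bounds the maximum by a proper fraction of itself. The speed factor \<open>\<alpha>\<close> is there because the
  competing curves are reparametrized integral curves.
\<close>

lemma integral_curves_eq:
  fixes X :: "'a::real_normed_vector \<Rightarrow> 'a"
  assumes "K \<ge> 0" "d \<ge> 0" "A * K * d < 1"
    and lip: "\<And>x y. x \<in> B \<Longrightarrow> y \<in> B \<Longrightarrow> norm (X x - X y) \<le> K * norm (x - y)"
    and \<alpha>: "\<And>t. t \<in> cball q d \<Longrightarrow> \<bar>\<alpha> t\<bar> \<le> A"
    and in_B: "c1 ` cball q d \<subseteq> B" "c2 ` cball q d \<subseteq> B"
    and der: "\<And>t. t \<in> cball q d \<Longrightarrow> (c1 has_vector_derivative \<alpha> t *\<^sub>R X (c1 t)) (at t)"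
      "\<And>t. t \<in> cball q d \<Longrightarrow> (c2 has_vector_derivative \<alpha> t *\<^sub>R X (c2 t)) (at t)"
    and eq: "c1 q = c2 q" and t: "t \<in> cball q d"
  shows "c1 t = c2 t"
proof -
  let ?g = "\<lambda>t. c1 t - c2 t"
  have "A \<ge> 0" using \<alpha>[OF t] by linarith
  have der_g: "(?g has_vector_derivative \<alpha> t *\<^sub>R (X (c1 t) - X (c2 t))) (at t)"
    if "t \<in> cball q d" for t
    using has_vector_derivative_diff[OF der(1)[OF that] der(2)[OF that]]
    by (simp add: scaleR_diff_right)
  have "continuous_on (cball q d) (\<lambda>t. norm (?g t))"
    using der_g has_vector_derivative_continuous
    by (intro continuous_on_norm continuous_at_imp_continuous_on) blast
  from continuous_attains_sup[OF compact_cball _ this] t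
  obtain s where s: "s \<in> cball q d" "\<And>t. t \<in> cball q d \<Longrightarrow> norm (?g t) \<le> norm (?g s)"
    by blast
  have "norm (?g s - ?g q) \<le> (A * K * norm (?g s)) * norm (s - q)"
  proof (rule differentiable_bound[OF convex_cball _ _ s(1)])
    fix t assume t: "t \<in> cball q d"
    show "(?g has_derivative (\<lambda>h. h *\<^sub>R (\<alpha> t *\<^sub>R (X (c1 t) - X (c2 t))))) (at t within cball q d)"
      using der_g[OF t] unfolding has_vector_derivative_def by (rule has_derivative_at_withinI)
    have "norm (X (c1 t) - X (c2 t)) \<le> K * norm (?g t)"
      using in_B t by (intro lip) auto
    also have "\<dots> \<le> K * norm (?g s)"
      using s(2)[OF t] \<open>K \<ge> 0\<close> by (rule mult_left_mono)
    finally have "norm (\<alpha> t *\<^sub>R (X (c1 t) - X (c2 t))) \<le> A * (K * norm (?g s))"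
      using \<alpha>[OF t] \<open>A \<ge> 0\<close> by (simp add: mult_mono)
    from mult_left_mono[OF this abs_ge_zero]
    show "onorm (\<lambda>h. h *\<^sub>R (\<alpha> t *\<^sub>R (X (c1 t) - X (c2 t)))) \<le> A * K * norm (?g s)"
      by (intro onorm_le) (metis mult.assoc mult.commute norm_scaleR real_norm_def)
  qed (use \<open>d \<ge> 0\<close> in auto)
  also have "\<dots> \<le> (A * K * norm (?g s)) * d"
    using s(1) \<open>A \<ge> 0\<close> \<open>K \<ge> 0\<close> by (intro mult_left_mono) (auto simp: dist_norm norm_minus_commute)
  finally have "norm (?g s) \<le> (A * K * d) * norm (?g s)"
    using eq by (simp add: algebra_simps)
  then have "(1 - A * K * d) * norm (?g s) \<le> 0"
    by (simp add: algebra_simps)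
  then have "norm (?g s) = 0"
    using assms(3) by (simp add: mult_le_0_iff)
  then show ?thesis using s(2)[OF t] by simp
qed

section \<open>Line fields\<close>

text \<open>
  Normalizing the field by \<open>l X = 1\<close> for a linear functional \<open>l\<close> makes \<open>l\<close> a parameter along its
  integral curves. Hence the reparametrization \<open>\<phi>\<close> taking a competing curve to the integral curve
  is \<open>l\<close> along the competitor, up to a constant: no quadrature of the speed is needed, and \<open>\<phi>\<close> is
  as smooth as the competitor.
\<close>

lemma line_field_local_curve:
  fixes X :: "real \<times> real \<Rightarrow> real \<times> real" and l :: "real \<times> real \<Rightarrow> real"
  assumes "open U" "p \<in> U" "smooth_on U X" and l: "bounded_linear l"
    and lX: "\<And>x. x \<in> U \<Longrightarrow> l (X x) = 1"
  obtains J c where "regular_curve_in U J c" "0 \<in> J" "c 0 = p"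
    "\<And>t. t \<in> J \<Longrightarrow> vector_derivative c (at t) = X (c t)"
    "\<And>D J' c' q'. regular_curve_in D J' c' \<Longrightarrow> q' \<in> J' \<Longrightarrow> c' q' = p \<Longrightarrow>
       (\<And>q. q \<in> J' \<Longrightarrow> c' q \<in> U \<Longrightarrow> \<exists>b. vector_derivative c' (at q) = b *\<^sub>R X (c' q)) \<Longrightarrow>
       locally_same_curve J' c' q' J c 0"
proof -
  have X0: "X x \<noteq> 0" if "x \<in> U" for x
    using lX[OF that] linear_0[OF bounded_linear.linear[OF l]] by auto
  obtain r where r: "r > 0" "cball p r \<subseteq> U"
    using \<open>open U\<close> \<open>p \<in> U\<close> open_contains_cball by blast
  obtain K where K: "K \<ge> 0"
    "\<And>x y. x \<in> cball p r \<Longrightarrow> y \<in> cball p r \<Longrightarrow> norm (X x - X y) \<le> K * norm (x - y)"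
    using smooth_on_imp_lipschitz_cball[OF \<open>smooth_on U X\<close> r(2)] by blast
  obtain T c where c: "T > 0" "c 0 = p" "c ` {-T<..<T} \<subseteq> ball p r"
    "\<And>t. t \<in> {-T<..<T} \<Longrightarrow> (c has_vector_derivative X (c t)) (at t)"
    using local_integral_curve[OF r(1) K] by blast
  define J where "J = {-T<..<T}"
  have in_U: "c ` J \<subseteq> U" using c(3) r(2) ball_subset_cball unfolding J_def by blast
  have vd: "vector_derivative c (at t) = X (c t)" if "t \<in> J" for t
    using c(4) that vector_derivative_at unfolding J_def by blast
  have smooth_c: "smooth_on J c"
    by (rule smooth_on_integral_curve[OF _ \<open>smooth_on U X\<close> in_U]) (use c(4) in \<open>auto simp: J_def\<close>)
  have reg: "regular_curve_in U J c"
  proof -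
    have "open_interval J"
      using \<open>T > 0\<close> by (simp add: open_interval_def J_def is_interval_oo)
    moreover have "vector_derivative c (at t) \<noteq> 0" if "t \<in> J" for t
      using X0[of "c t"] in_U vd[OF that] that by (metis image_subset_iff)
    ultimately show ?thesis
      using smooth_c in_U by (simp add: regular_curve_in_def)
  qed
  have unique: "locally_same_curve J' c' q' J c 0"
    if reg': "regular_curve_in D J' c'" and q': "q' \<in> J'" "c' q' = p"
      and par: "\<And>q. q \<in> J' \<Longrightarrow> c' q \<in> U \<Longrightarrow> \<exists>b. vector_derivative c' (at q) = b *\<^sub>R X (c' q)"
    for D J' c' q'
  proof -
    have "open J'" and smooth': "smooth_on J' c'"
      and nz: "\<And>q. q \<in> J' \<Longrightarrow> vector_derivative c' (at q) \<noteq> 0"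
      using reg' by (auto simp: regular_curve_in_def open_interval_def)
    define \<alpha> where "\<alpha> q = l (vector_derivative c' (at q))" for q
    define \<phi> where "\<phi> q = l (c' q) + - l p" for q
    define A where "A = \<bar>\<alpha> q'\<bar> + 1"
    have der': "(c' has_vector_derivative vector_derivative c' (at q)) (at q)" if "q \<in> J'" for q
      by (rule smooth_on_imp_has_vector_derivative[OF smooth' that])
    have der_\<phi>: "(\<phi> has_real_derivative \<alpha> q) (at q)" if "q \<in> J'" for q
      using bounded_linear.has_vector_derivative[OF l der'[OF that]]
      unfolding has_real_derivative_iff_has_vector_derivative \<phi>_def \<alpha>_def
      by (auto intro!: derivative_eq_intros)
    have vd': "vector_derivative c' (at q) = \<alpha> q *\<^sub>R X (c' q)" if q: "q \<in> J'" "c' q \<in> U" for q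
    proof -
      obtain b where b: "vector_derivative c' (at q) = b *\<^sub>R X (c' q)" using par[OF q] by blast
      then have "\<alpha> q = b"
        using lX[OF q(2)] linear_cmul[OF bounded_linear.linear[OF l]] by (simp add: \<alpha>_def)
      then show ?thesis using b by simp
    qed
    have cont_\<alpha>: "continuous_on J' \<alpha>"
      unfolding \<alpha>_def using bounded_linear.continuous_on[OF l]
        smooth_on_imp_continuous_on_vector_derivative[OF smooth'] by blast
    have cont_\<phi>: "continuous_on J' \<phi>"
      using der_\<phi> by (auto intro!: continuous_at_imp_continuous_on DERIV_isCont)
    note cont' = smooth_on_imp_continuous_on[OF smooth']
    have "open (J' \<inter> c' -` ball p r \<inter> \<phi> -` J \<inter> \<alpha> -` {-A<..<A})" (is "open ?V")
    proof -
      have "?V = (J' \<inter> c' -` ball p r) \<inter> (J' \<inter> \<phi> -` J) \<inter> (J' \<inter> \<alpha> -` {-A<..<A})" by blast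
      moreover have "open \<dots>"
        by (intro open_Int continuous_open_preimage cont' cont_\<alpha> cont_\<phi> \<open>open J'\<close>) (auto simp: J_def)
      ultimately show ?thesis by simp
    qed
    moreover have "q' \<in> ?V"
      using q' r(1) \<open>T > 0\<close> by (auto simp: \<phi>_def J_def A_def)
    ultimately obtain d0 where d0: "d0 > 0" "cball q' d0 \<subseteq> ?V"
      using open_contains_cball by blast
    have "A > 0" by (simp add: A_def)
    define d where "d = min d0 (1 / (A * K + 1))"
    have AK: "A * K \<ge> 0" using \<open>A > 0\<close> K(1) by simp
    have "d > 0" using d0(1) AK by (simp add: d_def)
    have "A * K * d \<le> A * K * (1 / (A * K + 1))"
      using AK by (intro mult_left_mono) (auto simp: d_def)
    also have "\<dots> < 1" using AK by (simp add: field_simps)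
    finally have AKd: "A * K * d < 1" .
    have V: "q \<in> J'" "c' q \<in> ball p r" "\<phi> q \<in> J" "\<bar>\<alpha> q\<bar> < A" "c' q \<in> U" if "q \<in> cball q' d" for q
    proof -
      have "q \<in> ?V" using that d0(2) by (auto simp: d_def)
      then show "q \<in> J'" "c' q \<in> ball p r" "\<phi> q \<in> J" "\<bar>\<alpha> q\<bar> < A" by auto
      then show "c' q \<in> U" using r(2) by auto
    qed
    have eq: "c' q = c (\<phi> q)" if "q \<in> cball q' d" for q
    proof (rule integral_curves_eq[of K d A "cball p r" X q' \<alpha> c' "\<lambda>q. c (\<phi> q)"])
      fix t assume t: "t \<in> cball q' d"
      show "(c' has_vector_derivative \<alpha> t *\<^sub>R X (c' t)) (at t)"
        using der' vd' V[OF t] by metis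
      have "(c has_vector_derivative X (c (\<phi> t))) (at (\<phi> t))"
        using c(4) V(3)[OF t] by (simp add: J_def)
      from vector_diff_chain_at[OF der_\<phi>[OF V(1)[OF t],
            unfolded has_real_derivative_iff_has_vector_derivative] this]
      show "((\<lambda>q. c (\<phi> q)) has_vector_derivative \<alpha> t *\<^sub>R X (c (\<phi> t))) (at t)"
        by (simp add: o_def)
    next
      show "c' ` cball q' d \<subseteq> cball p r" using V(2) by fastforce
      show "(\<lambda>q. c (\<phi> q)) ` cball q' d \<subseteq> cball p r"
        using V(3) c(3) ball_subset_cball unfolding J_def by blast
      show "c' q' = c (\<phi> q')" using q' c(2) by (simp add: \<phi>_def)
      show "\<bar>\<alpha> t\<bar> \<le> A" if "t \<in> cball q' d" for t using V(4)[OF that] by simp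
    qed (use K \<open>d > 0\<close> AKd that in auto)
    define I where "I = ball q' d"
    have I: "I \<subseteq> cball q' d" "open I" "is_interval I" "q' \<in> I"
      using \<open>d > 0\<close> by (auto simp: I_def is_interval_ball_real)
    have \<alpha>0: "\<alpha> q \<noteq> 0" if "q \<in> cball q' d" for q
      using nz[of q] vd'[of q] V[OF that] by auto
    have "\<phi> x \<noteq> \<phi> y" if "x \<in> I" "y \<in> I" "x < y" for x y
    proof
      assume "\<phi> x = \<phi> y"
      have sub: "{x..y} \<subseteq> cball q' d"
        using that by (auto simp: I_def dist_real_def)
      have "continuous_on {x..y} \<phi>"
        using continuous_on_subset[OF cont_\<phi>] sub V(1) by blast
      moreover have "\<phi> differentiable (at s)" if "x < s" "s < y" for s
      proof -
        have "s \<in> cball q' d" using subsetD[OF sub, of s] that by simp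
        from der_\<phi>[OF V(1)[OF this]] show ?thesis
          unfolding real_differentiable_def by blast
      qed
      ultimately obtain s where s: "x < s" "s < y" "(\<phi> has_real_derivative 0) (at s)"
        using Rolle[OF \<open>x < y\<close> \<open>\<phi> x = \<phi> y\<close>] by blast
      then have "s \<in> cball q' d" using subsetD[OF sub, of s] by simp
      then show False using DERIV_unique[OF der_\<phi>[OF V(1)] s(3)] \<alpha>0 by blast
    qed
    then have inj: "inj_on \<phi> I" by (metis inj_onI linorder_neqE_linordered_idom)
    have cont_I: "continuous_on I \<phi>"
      using continuous_on_subset[OF cont_\<phi>] I(1) V(1) by blast
    have "smooth_on I \<phi>"
      unfolding smooth_on_def
    proof
      fix n
      have "times_diff_on n I c'"
        using smooth' times_diff_on_subset I(1) V(1) unfolding smooth_on_def by blast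
      then have "times_diff_on n I (\<lambda>q. l (c' q) + - l p)"
        by (intro times_diff_on_add times_diff_on_bounded_linear[OF _ l] times_diff_on_const I(2))
      then show "times_diff_on n I \<phi>" by (simp add: \<phi>_def[abs_def])
    qed
    moreover have "open_interval (\<phi> ` I)"
      using I invariance_of_domain[OF cont_I I(2) inj] connected_continuous_image[OF cont_I]
      by (auto simp: open_interval_def is_interval_connected_1)
    moreover have "deriv \<phi> q \<noteq> 0" if "q \<in> I" for q
      using DERIV_imp_deriv[OF der_\<phi>[OF V(1)]] \<alpha>0 subsetD[OF I(1) that] by simp
    moreover have "\<phi> q' = 0" using q' by (simp add: \<phi>_def)
    ultimately show ?thesis
      unfolding locally_same_curve_def
      using V(1,3) eq inj I(1)
      by (intro exI[of _ I] exI[of _ "\<phi> ` I"] exI[of _ \<phi>] conjI ballI inj_on_imp_bij_betw I)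
         (use I in \<open>auto simp: open_interval_def\<close>)
  qed
  show thesis
    by (rule that[OF reg _ c(2) vd unique]) (use \<open>T > 0\<close> in \<open>auto simp: J_def\<close>)
qed

section \<open>Asymptotic tangents\<close>

text \<open>
  A multiple of a form with zero discriminant is a square in either of two ways, and the linear
  forms squared are the two components of its gradient, up to a factor.
\<close>

lemma degenerate_form_null_imp_radical:
  fixes L M N l m :: real
  assumes "L * N = M\<^sup>2" "L * l\<^sup>2 + 2 * M * l * m + N * m\<^sup>2 = 0"
  shows "L * l + M * m = 0" "M * l + N * m = 0"
proof -
  have "(L * l + M * m)\<^sup>2 = L * (L * l\<^sup>2 + 2 * M * l * m + N * m\<^sup>2)"
    using assms(1) by algebra
  then show "L * l + M * m = 0" using assms(2) by simp
  have "(M * l + N * m)\<^sup>2 = N * (L * l\<^sup>2 + 2 * M * l * m + N * m\<^sup>2)"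
    using assms(1) by algebra
  then show "M * l + N * m = 0" using assms(2) by simp
qed

definition asymptotic_form ::
    "(real \<times> real \<Rightarrow> real^4) \<Rightarrow> (real \<times> real \<Rightarrow> real^4) \<Rightarrow> (real \<times> real \<Rightarrow> real^4) \<Rightarrow>
     real \<times> real \<Rightarrow> real \<times> real \<Rightarrow> real" where
  "asymptotic_form z e1 e2 p a =
     coeff_L z e1 e2 p * (fst a)\<^sup>2 + 2 * coeff_M z e1 e2 p * fst a * snd a +
     coeff_N z e1 e2 p * (snd a)\<^sup>2"

locale surface_with_frame =
  fixes D :: "(real \<times> real) set" and z e1 e2 :: "real \<times> real \<Rightarrow> real^4"
  assumes surface: "regular_surface D z" and frame: "normal_frame D z e1 e2"
begin

lemma open_D: "open D" and smooth_z: "smooth_on D z"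
  using surface by (auto simp: regular_surface_def)

lemma bounded_linear_tangent_vec: "p \<in> D \<Longrightarrow> bounded_linear (tangent_vec z p)"
  using smooth_on_imp_has_derivative[OF smooth_z] has_derivative_bounded_linear
  unfolding tangent_vec_def[abs_def] by blast

lemma tangent_vec_eq:
  assumes "p \<in> D"
  shows "tangent_vec z p (l, m) = l *\<^sub>R z_u z p + m *\<^sub>R z_v z p"
proof -
  interpret bounded_linear "tangent_vec z p" by (rule bounded_linear_tangent_vec[OF assms])
  have "tangent_vec z p (l *\<^sub>R (1, 0) + m *\<^sub>R (0, 1)) = l *\<^sub>R z_u z p + m *\<^sub>R z_v z p"
    by (simp only: add scaleR z_u_def z_v_def)
  then show ?thesis by simp
qed

lemma tangent_by_eq: "p \<in> D \<Longrightarrow> tangent_by z p l m = span {tangent_vec z p (l, m)}"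
  by (simp add: tangent_by_def tangent_vec_eq)

lemma inj_tangent_vec: "p \<in> D \<Longrightarrow> inj (tangent_vec z p)"
  using surface by (simp add: regular_surface_def tangent_vec_def[abs_def])

lemma tangent_vec_eq_0_iff: "p \<in> D \<Longrightarrow> tangent_vec z p a = 0 \<longleftrightarrow> a = 0"
  using inj_tangent_vec bounded_linear_tangent_vec bounded_linear.linear linear_injective_0 linear_0
  by metis

lemma tangent_by_eqD:
  assumes "p \<in> D" "tangent_by z p l m = tangent_by z p l' m'"
  obtains s where "l = s * l'" "m = s * m'"
proof -
  have "tangent_vec z p (l, m) \<in> span {tangent_vec z p (l', m')}"
    using assms by (metis tangent_by_eq insertI1 span_base)
  then obtain s where "tangent_vec z p (l, m) = s *\<^sub>R tangent_vec z p (l', m')"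
    by (auto simp: span_singleton)
  also have "\<dots> = tangent_vec z p (s * l', s * m')"
    using linear_cmul[OF bounded_linear.linear[OF bounded_linear_tangent_vec[OF \<open>p \<in> D\<close>]]]
    by (metis scaleR_Pair real_scaleR_def)
  finally have "(l, m) = (s * l', s * m')"
    using inj_tangent_vec[OF \<open>p \<in> D\<close>] by (simp add: inj_eq)
  then show thesis using that by blast
qed

lemma asymptotic_tangent_iff:
  assumes "p \<in> D" "a \<noteq> 0"
  shows "asymptotic_tangent z e1 e2 p (tangent_by z p (fst a) (snd a)) \<longleftrightarrow>
    asymptotic_form z e1 e2 p a = 0"
    (is "?asym \<longleftrightarrow> ?null")
proof
  assume ?asym
  then obtain l1 m1 l2 m2 where
    nz: "(l1, m1) \<noteq> (0, 0)" "(l2, m2) \<noteq> (0, 0)" and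
    g: "tangent_by z p l1 m1 = tangent_by z p (fst a) (snd a)"
      "tangent_by z p l2 m2 = tangent_by z p (fst a) (snd a)" and
    zero: "coeff_L z e1 e2 p * l1 * l2 + coeff_M z e1 e2 p * (l1 * m2 + m1 * l2) +
      coeff_N z e1 e2 p * m1 * m2 = 0"
    unfolding asymptotic_tangent_def conjugate_tangents_def by metis
  obtain s where s: "l1 = s * fst a" "m1 = s * snd a" using tangent_by_eqD[OF assms(1) g(1)] .
  obtain t where t: "l2 = t * fst a" "m2 = t * snd a" using tangent_by_eqD[OF assms(1) g(2)] .
  have "s * t * asymptotic_form z e1 e2 p a = 0"
    using zero unfolding s t asymptotic_form_def by (simp add: algebra_simps power2_eq_square)
  then show ?null using nz s t by auto
next
  assume ?null
  then show ?asym
    unfolding asymptotic_tangent_def conjugate_tangents_def asymptotic_form_def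
    using \<open>a \<noteq> 0\<close>
    by (intro exI[of _ "fst a"] exI[of _ "snd a"])
       (auto simp: algebra_simps power2_eq_square prod_eq_iff)
qed

lemma perpendicular_tangent:
  assumes "p \<in> D" "(l, m) \<noteq> (0, 0)"
  obtains l' m' where "(l', m') \<noteq> (0, 0)" "tangent_vec z p (l, m) \<bullet> tangent_vec z p (l', m') = 0"
proof (rule that)
  \<comment> \<open>The inner products of the given vector with \<open>z\<^sub>u\<close> and \<open>z\<^sub>v\<close>, rotated by a right angle; they
    cannot both vanish, since the vector would then be orthogonal to itself.\<close>
  let ?l = "- (coeff_F z p * l + coeff_G z p * m)" and ?m = "coeff_E z p * l + coeff_F z p * m"
  have inner: "tangent_vec z p (l, m) \<bullet> tangent_vec z p (a, b) =
      a * (coeff_E z p * l + coeff_F z p * m) + b * (coeff_F z p * l + coeff_G z p * m)" for a b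
    using assms(1)
    by (simp add: tangent_vec_eq coeff_E_def coeff_F_def coeff_G_def inner_left_distrib
        inner_right_distrib inner_commute algebra_simps)
  show "tangent_vec z p (l, m) \<bullet> tangent_vec z p (?l, ?m) = 0"
    unfolding inner by (simp add: algebra_simps)
  show "(?l, ?m) \<noteq> (0, 0)"
  proof
    assume "(?l, ?m) = (0, 0)"
    then have "coeff_E z p * l + coeff_F z p * m = 0" "coeff_F z p * l + coeff_G z p * m = 0"
      by auto
    then have "tangent_vec z p (l, m) \<bullet> tangent_vec z p (l, m) = 0"
      unfolding inner by simp
    then show False using assms tangent_vec_eq_0_iff by (auto simp: zero_prod_def)
  qed
qed

lemma first_form_pos:
  assumes "p \<in> D"
  shows "coeff_E z p * coeff_G z p - (coeff_F z p)\<^sup>2 > 0"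
proof -
  let ?w = "coeff_E z p *\<^sub>R z_v z p - coeff_F z p *\<^sub>R z_u z p"
  have "z_u z p \<noteq> 0"
    using tangent_vec_eq_0_iff[OF assms] by (simp add: z_u_def zero_prod_def)
  then have E: "coeff_E z p > 0" by (simp add: coeff_E_def)
  have "?w = tangent_vec z p (- coeff_F z p, coeff_E z p)"
    using assms by (simp add: tangent_vec_eq)
  then have "?w \<noteq> 0" using E tangent_vec_eq_0_iff[OF assms] by (simp add: zero_prod_def)
  then have "0 < ?w \<bullet> ?w" by simp
  also have "?w \<bullet> ?w = coeff_E z p * (coeff_E z p * coeff_G z p - (coeff_F z p)\<^sup>2)"
    by (simp add: coeff_E_def coeff_F_def coeff_G_def inner_diff_left inner_diff_right
        inner_commute algebra_simps power2_eq_square)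
  finally show ?thesis using E by (simp add: zero_less_mult_iff)
qed

lemma coeff_W_pos: "p \<in> D \<Longrightarrow> coeff_W z p > 0"
  using first_form_pos by (simp add: coeff_W_def)

lemma curve_tangent_eq:
  assumes "regular_curve_in D J c" "q \<in> J"
  shows "curve_tangent z c q =
    tangent_by z (c q) (fst (vector_derivative c (at q))) (snd (vector_derivative c (at q)))"
proof -
  let ?v = "vector_derivative c (at q)"
  have cq: "c q \<in> D" and "smooth_on J c" using assms by (auto simp: regular_curve_in_def)
  have "(c has_vector_derivative ?v) (at q)"
    by (rule smooth_on_imp_has_vector_derivative[OF \<open>smooth_on J c\<close> assms(2)])
  from has_derivative_compose[OF this[unfolded has_vector_derivative_def]
      smooth_on_imp_has_derivative[OF smooth_z cq]]
  have "(z \<circ> c has_vector_derivative tangent_vec z (c q) ?v) (at q)"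
    using linear_cmul[OF bounded_linear.linear[OF bounded_linear_tangent_vec[OF cq]]]
    unfolding has_vector_derivative_def tangent_vec_def by (simp add: o_def)
  then show ?thesis
    using cq by (simp add: curve_tangent_def tangent_by_eq vector_derivative_at)
qed

lemma asymptotic_line_iff:
  "asymptotic_line D z e1 e2 J c \<longleftrightarrow> regular_curve_in D J c \<and>
     (\<forall>q\<in>J. asymptotic_form z e1 e2 (c q) (vector_derivative c (at q)) = 0)"
proof -
  have "asymptotic_tangent z e1 e2 (c q) (curve_tangent z c q) \<longleftrightarrow>
      asymptotic_form z e1 e2 (c q) (vector_derivative c (at q)) = 0"
    if reg: "regular_curve_in D J c" and q: "q \<in> J" for q
  proof -
    have "c q \<in> D" "vector_derivative c (at q) \<noteq> 0"
      using reg q by (auto simp: regular_curve_in_def)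
    from asymptotic_tangent_iff[OF this] show ?thesis
      using curve_tangent_eq[OF reg q] by simp
  qed
  then show ?thesis unfolding asymptotic_line_def by blast
qed

end

section \<open>The asymptotic direction field\<close>

text \<open>
  Multiplying \<open>L\<close>, \<open>M\<close>, \<open>N\<close> by \<open>W\<close> does not change null directions and leaves polynomials in the
  frame components of the second derivatives of \<open>z\<close>, which are smooth without differentiating a
  square root.
\<close>

definition frame_area ::
    "(real \<times> real \<Rightarrow> real^4) \<Rightarrow> (real \<times> real \<Rightarrow> real^4) \<Rightarrow> (real \<times> real \<Rightarrow> real^4) \<Rightarrow>
     real \<times> real \<Rightarrow> real \<times> real \<Rightarrow> real \<times> real \<Rightarrow> real \<times> real \<Rightarrow> real \<times> real \<Rightarrow> real" where
  "frame_area z e1 e2 a b a' b' p =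
     (second_derivative z p a b \<bullet> e1 p) * (second_derivative z p a' b' \<bullet> e2 p) -
     (second_derivative z p a b \<bullet> e2 p) * (second_derivative z p a' b' \<bullet> e1 p)"

context surface_with_frame
begin

lemma oriented_area_sigma:
  assumes "p \<in> D"
  shows "oriented_area e1 e2 p (sigma z e1 e2 p a b) (sigma z e1 e2 p a' b') =
    frame_area z e1 e2 a b a' b' p"
proof -
  have "e1 p \<bullet> e1 p = 1" "e2 p \<bullet> e2 p = 1" "e1 p \<bullet> e2 p = 0" "e2 p \<bullet> e1 p = 0"
    using frame assms by (auto simp: normal_frame_def norm_eq_1 inner_commute)
  then show ?thesis
    by (simp add: oriented_area_def sigma_def frame_area_def inner_add_left)
qed

lemma times_diff_on_frame_area: "times_diff_on n D (frame_area z e1 e2 a b a' b')"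
proof -
  have z2: "times_diff_on n D (\<lambda>p. second_derivative z p a b)" for a b
    using smooth_on_frechet_derivative[OF smooth_on_frechet_derivative[OF smooth_z]]
    by (simp add: second_derivative_def smooth_on_def)
  have e: "times_diff_on n D e1" "times_diff_on n D e2"
    using frame by (auto simp: normal_frame_def smooth_on_def)
  have prod: "times_diff_on n D (\<lambda>p. (second_derivative z p a b \<bullet> f p) * (second_derivative z p a' b' \<bullet> g p))"
    if "times_diff_on n D f" "times_diff_on n D g" for f g a b a' b'
    by (intro times_diff_on_bounded_bilinear[OF open_D bounded_bilinear_mult]
        times_diff_on_bounded_bilinear[OF open_D bounded_bilinear_inner] z2 that)
  have "times_diff_on n D (\<lambda>p.
      (second_derivative z p a b \<bullet> e1 p) * (second_derivative z p a' b' \<bullet> e2 p) +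
      - ((second_derivative z p a b \<bullet> e2 p) * (second_derivative z p a' b' \<bullet> e1 p)))"
    by (intro times_diff_on_add[OF open_D]
        times_diff_on_bounded_linear[OF open_D bounded_linear_minus[OF bounded_linear_ident]] prod e)
  then show ?thesis by (simp add: frame_area_def[abs_def])
qed

end

lemma smooth_on_quotient_scaleR_add:
  fixes f g :: "'a::real_normed_vector \<Rightarrow> real" and b c :: "'b::real_normed_vector"
  assumes "open D" "\<And>n. times_diff_on n D f" "\<And>n. times_diff_on n D g"
  shows "smooth_on (D \<inter> g -` (-{0})) (\<lambda>x. (f x * inverse (g x)) *\<^sub>R b + c)"
    and "open (D \<inter> g -` (-{0}))"
proof -
  show "open (D \<inter> g -` (-{0}))" (is "open ?U")
    using assms(3)[of 0] \<open>open D\<close> by (intro continuous_open_preimage) auto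
  show "smooth_on ?U (\<lambda>x. (f x * inverse (g x)) *\<^sub>R b + c)"
    unfolding smooth_on_def
    using \<open>open ?U\<close> times_diff_on_subset[OF assms(2), of ?U] times_diff_on_subset[OF assms(3), of ?U]
    by (intro allI times_diff_on_add times_diff_on_const
        times_diff_on_bounded_linear[OF _ bounded_linear_scaleR_left]
        times_diff_on_bounded_bilinear[OF _ bounded_bilinear_mult] times_diff_on_inverse) auto
qed

locale parabolic_surface = surface_with_frame +
  assumes no_flat: "\<forall>p\<in>D. \<not> flat_point z e1 e2 p"
    and k_zero: "\<forall>p\<in>D. invariant_k z e1 e2 p = 0"
begin

lemma coeff_discriminant:
  "p \<in> D \<Longrightarrow> coeff_L z e1 e2 p * coeff_N z e1 e2 p = (coeff_M z e1 e2 p)\<^sup>2"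
  using k_zero first_form_pos unfolding invariant_k_def by fastforce

text \<open>
  By \<open>L N = M\<^sup>2\<close> and the absence of flat points, \<open>L\<close> and \<open>N\<close> have no common zero. Where \<open>L\<close> is
  nonzero the form is \<open>(L \<lambda> + M \<mu>)\<^sup>2 / L\<close>, with null direction \<open>(- M / L, 1)\<close>; where \<open>N\<close> is
  nonzero the null direction is \<open>(1, - M / N)\<close>.
\<close>

lemma asymptotic_direction_field:
  assumes "p \<in> D"
  obtains U X l where "open U" "p \<in> U" "U \<subseteq> D" "smooth_on U X" "bounded_linear l"
    "\<And>x. x \<in> U \<Longrightarrow> l (X x) = 1"
    "\<And>x. x \<in> U \<Longrightarrow> asymptotic_form z e1 e2 x (X x) = 0"
    "\<And>x a. x \<in> U \<Longrightarrow> asymptotic_form z e1 e2 x a = 0 \<Longrightarrow> a = l a *\<^sub>R X x"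
proof -
  \<comment> \<open>\<open>?L\<close>, \<open>?M\<close>, \<open>?N\<close> are \<open>W / 2\<close> times \<open>L\<close>, \<open>- M\<close>, \<open>N\<close>; the sign is that of the null direction.\<close>
  let ?f = "frame_area z e1 e2"
  let ?L = "?f (1, 0) (1, 0) (1, 0) (0, 1)" and ?N = "?f (1, 0) (0, 1) (0, 1) (0, 1)"
  let ?M = "\<lambda>x. - (?f (1, 0) (1, 0) (0, 1) (0, 1) x / 2)"
  have smooth_M: "times_diff_on n D ?M" for n
    using times_diff_on_bounded_linear[OF open_D bounded_linear_mult_right[of "-1/2"]
        times_diff_on_frame_area] by (simp add: algebra_simps)
  have L: "coeff_L z e1 e2 x = 2 / coeff_W z x * ?L x"
    and M: "coeff_M z e1 e2 x = - 2 / coeff_W z x * ?M x"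
    and N: "coeff_N z e1 e2 x = 2 / coeff_W z x * ?N x" if "x \<in> D" for x
    using that by (simp_all add: coeff_L_def coeff_M_def coeff_N_def oriented_area_sigma)
  have W: "2 / coeff_W z x > 0" if "x \<in> D" for x
    using coeff_W_pos[OF that] by simp
  have disc: "?L x * ?N x = (?M x)\<^sup>2" if "x \<in> D" for x
  proof -
    have "(2 / coeff_W z x)\<^sup>2 * (?L x * ?N x) = (2 / coeff_W z x)\<^sup>2 * (?M x)\<^sup>2"
      using coeff_discriminant[OF that] unfolding L[OF that] M[OF that] N[OF that]
      by (simp add: power2_eq_square mult_ac)
    then show ?thesis using W[OF that] by (metis less_irrefl mult_cancel_left zero_eq_power2)
  qed
  have form: "asymptotic_form z e1 e2 x a = 2 / coeff_W z x *
      (?L x * (fst a)\<^sup>2 + 2 * (- ?M x) * fst a * snd a + ?N x * (snd a)\<^sup>2)" if "x \<in> D" for x a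
    unfolding asymptotic_form_def L[OF that] M[OF that] N[OF that] by (simp add: algebra_simps)
  have radical: "?L x * fst a + - ?M x * snd a = 0" "- ?M x * fst a + ?N x * snd a = 0"
    if "x \<in> D" "asymptotic_form z e1 e2 x a = 0" for x a
    using degenerate_form_null_imp_radical[of "?L x" "?N x" "- ?M x" "fst a" "snd a"]
      disc[OF that(1)] that(2) W[OF that(1)]
    unfolding form[OF that(1)] by (simp_all only: mult_eq_0_iff power2_minus) auto
  consider "?L p \<noteq> 0" | "?N p \<noteq> 0"
  proof (rule ccontr)
    assume "\<not> thesis"
    with that have "?L p = 0" "?N p = 0" by auto
    moreover from this have "?M p = 0" using disc[OF assms] by simp
    ultimately have "flat_point z e1 e2 p"
      by (simp only: flat_point_def L[OF assms] M[OF assms] N[OF assms] mult_zero_right)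
    then show False using no_flat assms by blast
  qed
  then show thesis
  proof cases
    case 1
    show thesis
    proof (rule that[of "D \<inter> ?L -` (-{0})" "\<lambda>x. (?M x * inverse (?L x)) *\<^sub>R (1, 0) + (0, 1)" snd])
      fix x assume x: "x \<in> D \<inter> ?L -` (-{0})"
      then have nz: "?L x \<noteq> 0" and "x \<in> D" by auto
      show "asymptotic_form z e1 e2 x ((?M x * inverse (?L x)) *\<^sub>R (1, 0) + (0, 1)) = 0"
        using nz disc[OF \<open>x \<in> D\<close>] unfolding form[OF \<open>x \<in> D\<close>] by (simp add: field_simps power2_eq_square)
      show "a = snd a *\<^sub>R ((?M x * inverse (?L x)) *\<^sub>R (1, 0) + (0, 1))"
        if "asymptotic_form z e1 e2 x a = 0" for a
        using radical(1)[OF \<open>x \<in> D\<close> that] nz by (simp add: prod_eq_iff field_simps)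
    next
      show "smooth_on (D \<inter> ?L -` (-{0})) (\<lambda>x. (?M x * inverse (?L x)) *\<^sub>R (1, 0) + (0, 1))"
        "open (D \<inter> ?L -` (-{0}))"
        by (rule smooth_on_quotient_scaleR_add[OF open_D smooth_M times_diff_on_frame_area])+
    qed (use 1 assms bounded_linear_snd in auto)
  next
    case 2
    show thesis
    proof (rule that[of "D \<inter> ?N -` (-{0})" "\<lambda>x. (?M x * inverse (?N x)) *\<^sub>R (0, 1) + (1, 0)" fst])
      fix x assume x: "x \<in> D \<inter> ?N -` (-{0})"
      then have nz: "?N x \<noteq> 0" and "x \<in> D" by auto
      show "asymptotic_form z e1 e2 x ((?M x * inverse (?N x)) *\<^sub>R (0, 1) + (1, 0)) = 0"
        using nz disc[OF \<open>x \<in> D\<close>] unfolding form[OF \<open>x \<in> D\<close>] by (simp add: field_simps power2_eq_square)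
      show "a = fst a *\<^sub>R ((?M x * inverse (?N x)) *\<^sub>R (0, 1) + (1, 0))"
        if "asymptotic_form z e1 e2 x a = 0" for a
        using radical(2)[OF \<open>x \<in> D\<close> that] nz by (simp add: prod_eq_iff field_simps)
    next
      show "smooth_on (D \<inter> ?N -` (-{0})) (\<lambda>x. (?M x * inverse (?N x)) *\<^sub>R (0, 1) + (1, 0))"
        "open (D \<inter> ?N -` (-{0}))"
        by (rule smooth_on_quotient_scaleR_add[OF open_D smooth_M times_diff_on_frame_area])+
    qed (use 2 assms bounded_linear_fst in auto)
  qed
qed

lemma ex_locally_unique_asymptotic_line:
  assumes "p \<in> D"
  shows "\<exists>J c q. asymptotic_line D z e1 e2 J c \<and> q \<in> J \<and> c q = p \<and>
    (\<forall>J' c' q'. asymptotic_line D z e1 e2 J' c' \<and> q' \<in> J' \<and> c' q' = p \<longrightarrow>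
       locally_same_curve J' c' q' J c q)"
proof -
  obtain U X l where U: "open U" "p \<in> U" "U \<subseteq> D" and X: "smooth_on U X" "bounded_linear l"
    "\<And>x. x \<in> U \<Longrightarrow> l (X x) = 1"
    and null: "\<And>x. x \<in> U \<Longrightarrow> asymptotic_form z e1 e2 x (X x) = 0"
    "\<And>x a. x \<in> U \<Longrightarrow> asymptotic_form z e1 e2 x a = 0 \<Longrightarrow> a = l a *\<^sub>R X x"
    using asymptotic_direction_field[OF assms] by blast
  obtain J c where c: "regular_curve_in U J c" "0 \<in> J" "c 0 = p"
    "\<And>t. t \<in> J \<Longrightarrow> vector_derivative c (at t) = X (c t)"
    and unique: "\<And>D J' c' q'. regular_curve_in D J' c' \<Longrightarrow> q' \<in> J' \<Longrightarrow> c' q' = p \<Longrightarrow>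
       (\<And>q. q \<in> J' \<Longrightarrow> c' q \<in> U \<Longrightarrow> \<exists>b. vector_derivative c' (at q) = b *\<^sub>R X (c' q)) \<Longrightarrow>
       locally_same_curve J' c' q' J c 0"
    using line_field_local_curve[OF U(1,2) X] by blast
  have "asymptotic_line D z e1 e2 J c"
    using c(1,4) U(3) null(1) unfolding asymptotic_line_iff regular_curve_in_def
    by (metis image_subset_iff subsetD)
  moreover have "locally_same_curve J' c' q' J c 0"
    if "asymptotic_line D z e1 e2 J' c'" "q' \<in> J'" "c' q' = p" for J' c' q'
  proof (rule unique[where c' = c' and q' = q', OF _ that(2,3)])
    show "regular_curve_in D J' c'"
      using that(1) by (simp add: asymptotic_line_iff)
    show "\<exists>b. vector_derivative c' (at q) = b *\<^sub>R X (c' q)" if "q \<in> J'" "c' q \<in> U" for q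
      using null(2)[OF that(2)] that(1) \<open>asymptotic_line D z e1 e2 J' c'\<close>
        asymptotic_line_iff by blast
  qed
  ultimately show ?thesis using c(2,3) by blast
qed

text \<open>
  A null vector of a degenerate form lies in its radical, so an asymptotic tangent is conjugate to
  every tangent, in particular to the one perpendicular to it.
\<close>

lemma asymptotic_line_imp_principal_line:
  assumes "asymptotic_line D z e1 e2 J c"
  shows "principal_line D z e1 e2 J c"
  unfolding principal_line_def
proof
  show reg: "regular_curve_in D J c" using assms by (simp add: asymptotic_line_def)
  show "\<forall>q\<in>J. principal_tangent z e1 e2 (c q) (curve_tangent z c q)"
  proof
    fix q assume q: "q \<in> J"
    obtain l m where v: "vector_derivative c (at q) = (l, m)" by fastforce
    have cq: "c q \<in> D" and nz: "(l, m) \<noteq> (0, 0)"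
      using reg q v by (force simp: regular_curve_in_def zero_prod_def)+
    have "asymptotic_form z e1 e2 (c q) (l, m) = 0"
      using assms q v by (metis asymptotic_line_iff)
    then have rad: "coeff_L z e1 e2 (c q) * l + coeff_M z e1 e2 (c q) * m = 0"
      "coeff_M z e1 e2 (c q) * l + coeff_N z e1 e2 (c q) * m = 0"
      using degenerate_form_null_imp_radical[OF coeff_discriminant[OF cq]]
      by (auto simp: asymptotic_form_def)
    obtain l' m' where perp: "(l', m') \<noteq> (0, 0)"
      "tangent_vec z (c q) (l, m) \<bullet> tangent_vec z (c q) (l', m') = 0"
      using perpendicular_tangent[OF cq nz] .
    have "coeff_L z e1 e2 (c q) * l * l' + coeff_M z e1 e2 (c q) * (l * m' + m * l') +
        coeff_N z e1 e2 (c q) * m * m' =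
        (coeff_L z e1 e2 (c q) * l + coeff_M z e1 e2 (c q) * m) * l' +
        (coeff_M z e1 e2 (c q) * l + coeff_N z e1 e2 (c q) * m) * m'"
      by (simp add: algebra_simps)
    then have "conjugate_tangents z e1 e2 (c q) (tangent_by z (c q) l m) (tangent_by z (c q) l' m')"
      unfolding conjugate_tangents_def using nz perp(1) rad by fastforce
    moreover have "orthogonal x y"
      if "x \<in> tangent_by z (c q) l m" "y \<in> tangent_by z (c q) l' m'" for x y
      using that perp(2) cq by (auto simp: tangent_by_eq span_singleton orthogonal_def)
    ultimately show "principal_tangent z e1 e2 (c q) (curve_tangent z c q)"
      unfolding principal_tangent_def curve_tangent_eq[OF reg q] v by auto
  qed
qed

end

theorem mainTheorem7:
  fixes D :: "(real \<times> real) set"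
    and z e1 e2 :: "real \<times> real \<Rightarrow> real^4"
  assumes surface: "regular_surface D z"
    and frame: "normal_frame D z e1 e2"
    and no_flat: "\<forall>p\<in>D. \<not> flat_point z e1 e2 p"
    and k_zero: "\<forall>p\<in>D. invariant_k z e1 e2 p = 0"
  shows "(\<forall>p\<in>D. \<exists>J c q. asymptotic_line D z e1 e2 J c \<and> q \<in> J \<and> c q = p \<and>
            (\<forall>J' c' q'. asymptotic_line D z e1 e2 J' c' \<and> q' \<in> J' \<and> c' q' = p \<longrightarrow>
               locally_same_curve J' c' q' J c q)) \<and>
         (\<forall>J c. asymptotic_line D z e1 e2 J c \<longrightarrow> principal_line D z e1 e2 J c)"
proof -
  interpret parabolic_surface D z e1 e2
    by unfold_locales (fact surface frame no_flat k_zero)+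
  show ?thesis
    using ex_locally_unique_asymptotic_line asymptotic_line_imp_principal_line by blast
qed

end
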